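(* If $f\in A^*(\mathbb{T})$ and $f(\xi)\ne0$ for all $\xi\in\mathbb{R}$, then $1/f\in A^*(\mathbb{T})$.
   Context: $A^*(\mathbb{T})$ is the Beurling algebra of periodic functions: the set of all functions of the form $f(\xi)=\sum_{n\in\mathbb{Z}}a(n)e^{-\sqrt{-1}\,n\xi}$, $\xi\in\mathbb{R}$, with complex coefficients satisfying $\sum_{k=0}^\infty\sup_{|n|\ge k}|a(n)|<\infty$. *)

theory Defs
  imports "HOL-Analysis.Analysis"
begin

(* The suprema and their sum are taken in ennreal, so that an unbounded coefficient
   sequence gives the value infinity and is excluded. *)
definition beurling_norm :: "(int \<Rightarrow> complex) \<Rightarrow> ennreal" where
  "beurling_norm a = (\<Sum>k::nat. SUP n\<in>{n::int. int k \<le> \<bar>n\<bar>}. ennreal (norm (a n)))"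

(* Finiteness of beurling_norm a forces the coefficients to be absolutely summable, so
   unconditional summation (has_sum) agrees with any other reading of the sum over n. *)
definition beurling_algebra :: "(real \<Rightarrow> complex) set" where
  "beurling_algebra =
    {f. \<exists>a :: int \<Rightarrow> complex.
          beurling_norm a < \<infinity> \<and>
          (\<forall>\<xi>::real. ((\<lambda>n::int. a n * exp (- \<i> * of_int n * of_real \<xi>)) has_sum f \<xi>) UNIV)}"

end

theory Submission
  imports Defs "HOL-Computational_Algebra.Fundamental_Theorem_Algebra"
begin

text \<open>
  Following Newman's proof of Wiener's lemma, write $f = P - U$ with $P$ a trigonometric polynomial
  and $U$ small in the Beurling norm, and expand $1/f = \sum_j U^j / P^{j+1}$. The Beurling norm is
  submultiplicative up to a constant, which controls $U^j$. As $P$ has no zero in a thin annulus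
  around the unit circle, factoring it into linear factors gives a Laurent expansion of $1/P$ there,
  and Cauchy's estimates on the two boundary circles bound the coefficients of $P^{-j}$ by
  $M^j \rho^{-|n|}$ with $M$ a fixed multiple of $1/\min |f|$. So the series converges geometrically.
\<close>

section \<open>The Beurling norm\<close>

text \<open>The least admissible \<open>G k\<close> is the supremum of \<open>norm (a n)\<close>
  over \<bar>n\<bar> \<ge> k, so this says that the Beurling norm is at most \<open>C\<close>.
  Asking for any real antitone majorant lets estimates be proved by exhibiting one, without suprema
  or infinite values.\<close>

definition beurling_bound :: "(int \<Rightarrow> complex) \<Rightarrow> real \<Rightarrow> bool" where
  "beurling_bound a C \<longleftrightarrow>
    (\<exists>G. antimono G \<and> (\<forall>n. norm (a n) \<le> G (nat \<bar>n\<bar>)) \<and> summable G \<and> suminf G \<le> C)"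

lemma beurling_boundI:
  assumes "antimono G" "\<And>n. norm (a n) \<le> G (nat \<bar>n\<bar>)" "summable G" "suminf G \<le> C"
  shows "beurling_bound a C"
  using assms unfolding beurling_bound_def by blast

lemma beurling_boundE:
  assumes "beurling_bound a C"
  obtains G where "antimono G" "\<And>n. norm (a n) \<le> G (nat \<bar>n\<bar>)" "\<And>k. 0 \<le> G k"
    "summable G" "suminf G \<le> C"
proof -
  from assms obtain G where G: "antimono G" "\<And>n. norm (a n) \<le> G (nat \<bar>n\<bar>)" "summable G" "suminf G \<le> C"
    unfolding beurling_bound_def by blast
  have "0 \<le> G k" for k
    using order_trans[OF norm_ge_zero G(2)[of "int k"]] by simp
  with G that show ?thesis by blast
qed

lemma beurling_bound_nonneg:
  assumes "beurling_bound a C"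
  shows "0 \<le> C"
  using assms by (rule beurling_boundE) (meson order_trans suminf_nonneg)

lemma beurling_norm_finite_if_bound:
  assumes "beurling_bound a C"
  shows "beurling_norm a < \<infinity>"
proof -
  obtain G where G: "antimono G" "\<And>n. norm (a n) \<le> G (nat \<bar>n\<bar>)" "\<And>k. 0 \<le> G k" "summable G"
    using assms by (rule beurling_boundE) blast
  have "beurling_norm a \<le> (\<Sum>k. ennreal (G k))"
    unfolding beurling_norm_def
  proof (intro suminf_le SUP_least allI)
    fix k :: nat and n :: int
    assume "n \<in> {n. int k \<le> \<bar>n\<bar>}"
    then have "G (nat \<bar>n\<bar>) \<le> G k"
      by (intro antimonoD[OF G(1)]) auto
    with G(2)[of n] show "ennreal (norm (a n)) \<le> ennreal (G k)"
      by (intro ennreal_leI) linarith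
  qed auto
  also have "\<dots> = ennreal (suminf G)"
    using G by (intro suminf_ennreal2) auto
  finally show ?thesis
    by (simp add: le_less_trans)
qed

text \<open>The tail suprema themselves form the majorant: a finite sum forces every term to be
  finite, so \<open>enn2real\<close> loses nothing.\<close>

lemma beurling_bound_if_norm_finite:
  assumes "beurling_norm a < \<infinity>"
  obtains C where "beurling_bound a C"
proof -
  define T where "T k = (SUP n\<in>{n::int. int k \<le> \<bar>n\<bar>}. ennreal (norm (a n)))" for k :: nat
  have fin: "(\<Sum>k. T k) \<noteq> \<infinity>"
    using assms unfolding beurling_norm_def T_def by auto
  have T_fin: "T k < \<infinity>" for k
  proof (rule ccontr)
    assume "\<not> T k < \<infinity>"
    then have "T k = \<infinity>" using less_top[of "T k"] by auto
    moreover have "T k \<le> (\<Sum>k. T k)"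
      using sum_le_suminf[of T "{k}"] by auto
    ultimately show False using fin by (simp add: top_unique)
  qed
  have T_eq: "ennreal (enn2real (T k)) = T k" for k
    using T_fin[of k] by (simp add: ennreal_enn2real_if less_top)
  have "beurling_bound a (\<Sum>k. enn2real (T k))"
  proof (rule beurling_boundI[where G = "\<lambda>k. enn2real (T k)"])
    have "T l \<le> T k" if "k \<le> l" for k l
      unfolding T_def by (rule SUP_subset_mono) (use that in auto)
    then show "antimono (\<lambda>k. enn2real (T k))"
      using T_fin by (auto intro!: antimonoI enn2real_mono)
    show "norm (a n) \<le> enn2real (T (nat \<bar>n\<bar>))" for n
    proof -
      have "ennreal (norm (a n)) \<le> T (nat \<bar>n\<bar>)"
        unfolding T_def by (rule SUP_upper) auto
      then have "enn2real (ennreal (norm (a n))) \<le> enn2real (T (nat \<bar>n\<bar>))"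
        using T_fin by (intro enn2real_mono) auto
      then show ?thesis by simp
    qed
    show "summable (\<lambda>k. enn2real (T k))"
      using fin by (intro summable_suminf_not_top) (auto simp: T_eq)
  qed auto
  with that show ?thesis .
qed

section \<open>Absolute summability of the coefficients\<close>

lemma sum_symmetric_interval_le:
  fixes G :: "nat \<Rightarrow> real"
  assumes "\<And>k. 0 \<le> G k"
  shows "(\<Sum>n\<in>{-int K..int K}. G (nat \<bar>n\<bar>)) \<le> 2 * (\<Sum>k<Suc K. G k)"
proof (induction K)
  case 0
  then show ?case using assms[of 0] by simp
next
  case (Suc K)
  have "{-int (Suc K)..int (Suc K)} = insert (int (Suc K)) (insert (-int (Suc K)) {-int K..int K})"
    by auto
  then have "(\<Sum>n\<in>{-int (Suc K)..int (Suc K)}. G (nat \<bar>n\<bar>))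
      = 2 * G (Suc K) + (\<Sum>n\<in>{-int K..int K}. G (nat \<bar>n\<bar>))"
    by (simp add: nat_add_distrib)
  with Suc show ?case by simp
qed

text \<open>Each modulus is attained by at most two integers, which costs the factor 2 over the sum
  of the majorant.\<close>

lemma beurling_bound_abs_summable:
  assumes "beurling_bound a C"
  shows "(\<lambda>n. norm (a n)) summable_on UNIV" "(\<Sum>\<^sub>\<infinity>n. norm (a n)) \<le> 2 * C"
proof -
  obtain G where G: "\<And>n. norm (a n) \<le> G (nat \<bar>n\<bar>)" "\<And>k. 0 \<le> G k" "summable G" "suminf G \<le> C"
    using assms by (rule beurling_boundE) blast
  have bound: "(\<Sum>n\<in>F. norm (a n)) \<le> 2 * C" if "finite F" for F
  proof -
    \<comment> \<open>\<open>K\<close> is the largest modulus in \<open>F\<close>; inserting 0 keeps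
      \<open>Max\<close> meaningful for empty \<open>F\<close>.\<close>
    define K where "K = nat (Max (insert 0 (abs ` F)))"
    have "\<bar>n\<bar> \<le> int K" if "n \<in> F" for n
      using that \<open>finite F\<close> unfolding K_def by (simp add: Max_ge_iff)
    then have "F \<subseteq> {-int K..int K}" by (force simp: abs_le_iff)
    then have "(\<Sum>n\<in>F. norm (a n)) \<le> (\<Sum>n\<in>{-int K..int K}. norm (a n))"
      by (intro sum_mono2) auto
    also have "\<dots> \<le> (\<Sum>n\<in>{-int K..int K}. G (nat \<bar>n\<bar>))"
      by (intro sum_mono G)
    also have "\<dots> \<le> 2 * (\<Sum>k<Suc K. G k)"
      by (rule sum_symmetric_interval_le) (rule G)
    also have "(\<Sum>k<Suc K. G k) \<le> suminf G"
      by (intro sum_le_suminf) (use G in auto)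
    finally show ?thesis using G by simp
  qed
  show "(\<lambda>n. norm (a n)) summable_on UNIV"
    by (rule nonneg_bdd_above_summable_on) (auto intro!: bdd_aboveI2[where M="2 * C"] bound)
  then show "(\<Sum>\<^sub>\<infinity>n. norm (a n)) \<le> 2 * C"
    by (rule infsum_le_finite_sums) (rule bound)
qed

text \<open>Every value of \<open>G\<close> is taken exactly twice. This is the price of halving the
  index when a convolution is estimated.\<close>

lemma suminf_half_index:
  fixes G :: "nat \<Rightarrow> real"
  assumes "\<And>k. 0 \<le> G k" "summable G"
  shows "summable (\<lambda>k. G (k div 2))" "(\<Sum>k. G (k div 2)) \<le> 2 * suminf G"
proof -
  have "(\<Sum>k<n. G (k div 2)) \<le> 2 * suminf G" for n
  proof -
    have "(\<Sum>k<n. G (k div 2)) \<le> (\<Sum>k<2*n. G (k div 2))"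
      by (intro sum_mono2) (use assms in auto)
    also have "\<dots> = 2 * (\<Sum>k<n. G k)"
      by (induction n) auto
    also have "(\<Sum>k<n. G k) \<le> suminf G"
      by (intro sum_le_suminf) (use assms in auto)
    finally show ?thesis by simp
  qed
  moreover from this show "summable (\<lambda>k. G (k div 2))"
    using assms by (intro summableI_nonneg_bounded) auto
  ultimately show "(\<Sum>k. G (k div 2)) \<le> 2 * suminf G"
    by (intro suminf_le_const)
qed

section \<open>Products of Laurent series\<close>

definition conv :: "(int \<Rightarrow> complex) \<Rightarrow> (int \<Rightarrow> complex) \<Rightarrow> int \<Rightarrow> complex" where
  "conv a b n = (\<Sum>\<^sub>\<infinity>m. a m * b (n - m))"

text \<open>In a product $a_m b_{n-m}$ one of the two indices has modulus at least $|n|/2$.\<close>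
lemma beurling_bound_conv:
  assumes "beurling_bound a C" "beurling_bound b D"
  shows "beurling_bound (conv a b) (8 * C * D)"
proof -
  obtain A where A: "antimono A" "\<And>n. norm (a n) \<le> A (nat \<bar>n\<bar>)" "\<And>k. 0 \<le> A k" "summable A" "suminf A \<le> C"
    using assms(1) by (rule beurling_boundE) blast
  obtain B where B: "antimono B" "\<And>n. norm (b n) \<le> B (nat \<bar>n\<bar>)" "\<And>k. 0 \<le> B k" "summable B" "suminf B \<le> D"
    using assms(2) by (rule beurling_boundE) blast
  note a1 = beurling_bound_abs_summable[OF assms(1)]
  note b1 = beurling_bound_abs_summable[OF assms(2)]
  have CD: "0 \<le> C" "0 \<le> D" using assms by (auto dest: beurling_bound_nonneg)
  \<comment> \<open>The factors \<open>2 * D\<close> and \<open>2 * C\<close> bound the absolute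
    sums of \<open>b\<close> and \<open>a\<close>. Halving the index doubles each sum once more, so
    each summand contributes at most \<open>4 * C * D\<close>.\<close>
  define G where "G k = A (k div 2) * (2 * D) + B (k div 2) * (2 * C)" for k
  note halfA = suminf_half_index[OF A(3,4)]
  note halfB = suminf_half_index[OF B(3,4)]
  show ?thesis
  proof (rule beurling_boundI[where G = G])
    show "antimono G"
      unfolding G_def using CD
      by (intro antimonoI add_mono mult_right_mono antimonoD[OF A(1)] antimonoD[OF B(1)] div_le_mono) auto
    show "norm (conv a b n) \<le> G (nat \<bar>n\<bar>)" for n
    proof -
      define k where "k = nat \<bar>n\<bar> div 2"
      have pt: "norm (a m * b (n - m)) \<le> A k * norm (b (n - m)) + B k * norm (a m)" for m
      proof (cases "k \<le> nat \<bar>m\<bar>")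
        case True
        then have "norm (a m) \<le> A k" using A(2)[of m] antimonoD[OF A(1) True] by linarith
        then have "norm (a m) * norm (b (n - m)) \<le> A k * norm (b (n - m))" 
          by (intro mult_right_mono) auto
        moreover have "0 \<le> B k * norm (a m)" using B(3) by simp
        ultimately show ?thesis unfolding norm_mult by linarith
      next
        case False
        then have "k \<le> nat \<bar>n - m\<bar>" unfolding k_def by linarith
        then have "norm (b (n - m)) \<le> B k" 
          using B(2)[of "n - m"] antimonoD[OF B(1)] by (meson order_trans)
        then have "norm (a m) * norm (b (n - m)) \<le> norm (a m) * B k" 
          by (intro mult_left_mono) auto
        moreover have "0 \<le> A k * norm (b (n - m))" using A(3) by simp
        ultimately show ?thesis unfolding norm_mult by (simp add: mult.commute)
      qed
      have bs: "((\<lambda>m. norm (b (n - m))) has_sum (\<Sum>\<^sub>\<infinity>m. norm (b m))) UNIV"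
      proof -
        have "((\<lambda>m. norm (b m)) has_sum (\<Sum>\<^sub>\<infinity>m. norm (b m))) UNIV \<longleftrightarrow> ?thesis"
          by (rule has_sum_reindex_bij_witness[of _ "\<lambda>m. n - m" "\<lambda>m. n - m"]) auto
        with b1(1) show ?thesis by auto
      qed
      have rhs: "((\<lambda>m. A k * norm (b (n - m)) + B k * norm (a m)) has_sum
          (A k * (\<Sum>\<^sub>\<infinity>m. norm (b m)) + B k * (\<Sum>\<^sub>\<infinity>m. norm (a m)))) UNIV"
        using a1(1) by (intro has_sum_add has_sum_cmult_right bs) auto
      have abs: "(\<lambda>m. norm (a m * b (n - m))) summable_on UNIV"
        by (rule summable_on_comparison_test[OF has_sum_imp_summable[OF rhs]]) (use pt in auto)
      have "norm (conv a b n) \<le> (\<Sum>\<^sub>\<infinity>m. norm (a m * b (n - m)))"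
        unfolding conv_def by (rule norm_infsum_bound[OF abs])
      also have "\<dots> \<le> A k * (\<Sum>\<^sub>\<infinity>m. norm (b m)) + B k * (\<Sum>\<^sub>\<infinity>m. norm (a m))"
        using has_sum_mono[OF has_sum_infsum[OF abs] rhs] pt by auto
      also have "\<dots> \<le> A k * (2 * D) + B k * (2 * C)"
        using a1 b1 A B by (intro add_mono mult_left_mono) auto
      finally show ?thesis unfolding G_def k_def .
    qed
    show sG: "summable G"
      unfolding G_def by (intro summable_add summable_mult2 halfA halfB)
    have "suminf G = (\<Sum>k. A (k div 2)) * (2 * D) + (\<Sum>k. B (k div 2)) * (2 * C)"
      unfolding G_def using halfA halfB
      by (subst suminf_add[symmetric]) (auto intro!: summable_mult2 simp: suminf_mult2[symmetric])
    also have "\<dots> \<le> (2 * C) * (2 * D) + (2 * D) * (2 * C)"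
      using halfA(2) halfB(2) A(5) B(5) CD by (intro add_mono mult_right_mono) linarith+
    finally show "suminf G \<le> 8 * C * D" by (simp add: mult_ac)
  qed
qed

text \<open>Both series converge absolutely, so their product may be rearranged by total exponent.
  Only convergence at the point \<open>z\<close> is assumed, so the lemma serves on an annulus as
  well as on the unit circle.\<close>

lemma has_sum_conv:
  assumes "z \<noteq> 0"
    and "((\<lambda>n. a n * z powi n) has_sum v) UNIV"
    and "((\<lambda>n. b n * z powi n) has_sum w) UNIV"
  shows "((\<lambda>n. conv a b n * z powi n) has_sum (v * w)) UNIV"
proof -
  let ?f = "\<lambda>(m, n). (a m * z powi m) * (b n * z powi n)"
  have sa: "(\<lambda>n. norm (a n * z powi n)) summable_on UNIV"
    by (rule summable_on_iff_abs_summable_on_complex[THEN iffD1, OF has_sum_imp_summable[OF assms(2)]])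
  have sb: "(\<lambda>n. norm (b n * z powi n)) summable_on UNIV"
    by (rule summable_on_iff_abs_summable_on_complex[THEN iffD1, OF has_sum_imp_summable[OF assms(3)]])
  have "(\<lambda>x. norm (?f x)) summable_on UNIV \<times> UNIV"
  proof (rule summable_on_SigmaI)
    show "((\<lambda>n. norm (?f (m, n))) has_sum norm (a m * z powi m) * (\<Sum>\<^sub>\<infinity>n. norm (b n * z powi n))) UNIV" for m
      using has_sum_cmult_right[OF has_sum_infsum[OF sb], of "norm (a m * z powi m)"] 
      by (simp add: norm_mult)
    show "(\<lambda>m. norm (a m * z powi m) * (\<Sum>\<^sub>\<infinity>n. norm (b n * z powi n))) summable_on UNIV"
      using sa by (rule summable_on_cmult_left)
  qed auto
  then have "?f summable_on UNIV \<times> UNIV" by (rule abs_summable_summable)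
  then have "(?f has_sum (v * w)) (UNIV \<times> UNIV)"
  proof (rule has_sum_SigmaI[rotated 2])
    show "((\<lambda>n. ?f (m, n)) has_sum (a m * z powi m) * w) UNIV" for m
      using has_sum_cmult_right[OF assms(3)] by simp
    show "((\<lambda>m. (a m * z powi m) * w) has_sum (v * w)) UNIV"
      using has_sum_cmult_left[OF assms(2)] by simp
  qed
  \<comment> \<open>The shear sending (m, n) to (m + n, m) collects equal powers of
    \<open>z\<close>; merging the two powers is where z \<noteq> 0 enters.\<close>
  then have *: "((\<lambda>(n, m). a m * b (n - m) * z powi n) has_sum (v * w)) (UNIV \<times> UNIV)"
  proof (subst has_sum_reindex_bij_witness[of _ "\<lambda>(m, n). (m + n, m)" "\<lambda>(n, m). (m, n - m)"])
  qed (use assms(1) in \<open>auto simp: power_int_add[symmetric] mult_ac\<close>)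
  show ?thesis
  proof (rule has_sum_SigmaD[OF *])
    fix n :: int
    have "(\<lambda>m. a m * b (n - m) * z powi n) summable_on UNIV"
      using summable_on_SigmaD1[where f = "\<lambda>n m. a m * b (n - m) * z powi n", OF has_sum_imp_summable[OF *]] by simp
    then have "((\<lambda>m. a m * b (n - m) * z powi n) has_sum (\<Sum>\<^sub>\<infinity>m. a m * b (n - m) * z powi n)) UNIV"
      by (rule has_sum_infsum)
    also have "(\<Sum>\<^sub>\<infinity>m. a m * b (n - m) * z powi n) = conv a b n * z powi n"
      unfolding conv_def by (rule infsum_cmult_left') 
    finally show "((\<lambda>m. case (n, m) of (n, m) \<Rightarrow> a m * b (n - m) * z powi n) has_sum conv a b n * z powi n) UNIV"
      by simp
  qed
qed

lemma has_sum_monomial: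
  "((\<lambda>n. (if n = m then c else 0) * z powi n) has_sum (c * z powi m)) UNIV" for c z :: complex
  by (rule has_sum_finite_neutralI[of "{m}"]) auto

lemma beurling_bound_delta: "beurling_bound (\<lambda>n. if n = 0 then 1 else 0) 1"
proof -
  have s: "(\<lambda>k::nat. if k = 0 then 1 else 0 :: real) sums 1"
    using sums_single[of 0 "\<lambda>_. 1 :: real"] by simp
  then show ?thesis
    by (intro beurling_boundI[where G = "\<lambda>k. if k = 0 then 1 else 0"])
      (auto intro!: antimonoI simp: sums_iff)
qed

lemma beurling_bound_geometric:
  assumes "0 < q" "q < 1" "0 \<le> K" "\<And>n. norm (b n) \<le> K * q ^ nat \<bar>n\<bar>"
  shows "beurling_bound b (K / (1 - q))"
proof (rule beurling_boundI[where G = "\<lambda>k. K * q ^ k"])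
  show "antimono (\<lambda>k. K * q ^ k)"
    using assms by (intro antimonoI mult_left_mono power_decreasing) auto
  have "(\<lambda>k. K * q ^ k) sums (K * (1 / (1 - q)))"
    using assms by (intro sums_mult geometric_sums) auto
  then show "summable (\<lambda>k. K * q ^ k)" "(\<Sum>k. K * q ^ k) \<le> K / (1 - q)"
    by (auto simp: sums_iff)
qed (use assms in auto)

section \<open>Infinite sums of coefficient sequences, and truncation\<close>

text \<open>Countable subadditivity: majorants chosen for the individual sequences add up to a
  majorant of the sum, and exchanging the order of summation bounds its total.\<close>

lemma beurling_bound_series:
  assumes "\<And>j. beurling_bound (c j) (C j)" "summable C"
  shows "beurling_bound (\<lambda>n. \<Sum>j. c j n) (suminf C)"
proof -
  have "\<exists>G. antimono G \<and> (\<forall>n. norm (c j n) \<le> G (nat \<bar>n\<bar>)) \<and> (\<forall>k. 0 \<le> G k) \<and> summable G \<and> suminf G \<le> C j" for j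
    using beurling_boundE[OF assms(1)[of j]] by metis
  then obtain G where G: "\<And>j. antimono (G j)" "\<And>j n. norm (c j n) \<le> G j (nat \<bar>n\<bar>)"
    "\<And>j k. 0 \<le> G j k" "\<And>j. summable (G j)" "\<And>j. suminf (G j) \<le> C j"
    by metis
  have partial: "(\<Sum>k<K. G j k) \<le> C j" for j K
    using sum_le_suminf[OF G(4), of "{..<K}" j] G(3,5) by (meson finite_lessThan order_trans)
  have G_le: "G j k \<le> C j" for j k
    using sum_le_suminf[OF G(4), of "{k}" j] G(3) G(5)[of j] by auto
  have sG: "summable (\<lambda>j. G j k)" for k
    by (rule summable_comparison_test'[OF assms(2)]) (use G(3) G_le in auto)
  \<comment> \<open>Bounding partial sums in \<open>k\<close> is enough for nonnegative terms, so
    only a finite sum is exchanged with a series.\<close>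
  have bound: "(\<Sum>k<K. \<Sum>j. G j k) \<le> suminf C" for K
  proof -
    have "(\<Sum>k<K. \<Sum>j. G j k) = (\<Sum>j. \<Sum>k<K. G j k)"
      by (rule suminf_sum[symmetric]) (rule sG)
    also have "\<dots> \<le> suminf C"
      by (intro suminf_le partial summable_sum sG assms(2))
    finally show ?thesis .
  qed
  show ?thesis
  proof (rule beurling_boundI[where G = "\<lambda>k. \<Sum>j. G j k"])
    show "antimono (\<lambda>k. \<Sum>j. G j k)"
      by (intro antimonoI suminf_le sG antimonoD[OF G(1)])
    show "norm (\<Sum>j. c j n) \<le> (\<Sum>j. G j (nat \<bar>n\<bar>))" for n
    proof -
      have s: "summable (\<lambda>j. norm (c j n))"
        by (rule summable_comparison_test'[OF sG]) (use G(2) in auto)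
      show ?thesis
        using summable_norm[OF s] suminf_le[OF G(2) s sG] by linarith
    qed
    show "summable (\<lambda>k. \<Sum>j. G j k)"
      by (rule summableI_nonneg_bounded[OF _ bound]) (intro suminf_nonneg sG G(3))
    then show "(\<Sum>k. \<Sum>j. G j k) \<le> suminf C"
      by (rule suminf_le_const) (rule bound)
  qed
qed

text \<open>On the unit circle row \<open>j\<close> of the double family has absolute sum at most
  \<open>2 * C j\<close>, so the whole family is absolutely summable. Summing by rows gives
  \<open>H\<close>, summing by columns gives the claimed expansion.\<close>

lemma has_sum_series:
  fixes h :: "nat \<Rightarrow> complex"
  assumes "\<And>j. beurling_bound (c j) (C j)" "summable C" "norm z = 1"
    and "\<And>j. ((\<lambda>n. c j n * z powi n) has_sum h j) UNIV" "h sums H"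
  shows "((\<lambda>n. (\<Sum>j. c j n) * z powi n) has_sum H) UNIV"
proof -
  note l1 = beurling_bound_abs_summable[OF assms(1)]
  let ?f = "\<lambda>(j, n). c j n * z powi n"
  have nz: "norm (x * z powi n) = norm x" for x n
    using assms(3) by (simp add: norm_mult norm_power_int)
  have "(\<lambda>x. norm (?f x)) summable_on UNIV \<times> UNIV"
  proof (rule summable_on_SigmaI)
    show "((\<lambda>n. norm (?f (j, n))) has_sum (\<Sum>\<^sub>\<infinity>n. norm (c j n))) UNIV" for j
      using l1(1)[of j] by (simp add: nz)
    have "summable (\<lambda>j. \<Sum>\<^sub>\<infinity>n. norm (c j n))"
      by (rule summable_comparison_test'[OF summable_mult[OF assms(2), of 2]])
        (use l1(2) in \<open>auto simp: infsum_nonneg\<close>)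
    then show "(\<lambda>j. \<Sum>\<^sub>\<infinity>n. norm (c j n)) summable_on UNIV"
      by (intro norm_summable_imp_summable_on) (simp add: infsum_nonneg)
  qed auto
  then have "?f summable_on UNIV \<times> UNIV" by (rule abs_summable_summable)
  then obtain S where S: "(?f has_sum S) (UNIV \<times> UNIV)" by (auto simp: summable_on_def)
  have "(h has_sum S) UNIV"
    by (rule has_sum_SigmaD[OF S]) (use assms(4) in simp)
  then have "S = H"
    using assms(5) has_sum_imp_sums sums_unique2 by blast
  with S have "((\<lambda>(n, j). c j n * z powi n) has_sum H) (UNIV \<times> UNIV)"
    using has_sum_swap[where f = ?f and A = UNIV and B = UNIV] by (simp add: case_prod_unfold)
  then show ?thesis
  proof (rule has_sum_SigmaD)
    fix n :: int
    have "norm (c j n) \<le> 2 * C j" for j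
    proof -
      have "norm (c j n) \<le> (\<Sum>\<^sub>\<infinity>n. norm (c j n))"
        using finite_sum_le_infsum[OF l1(1)[of j], of "{n}"] by simp
      with l1(2)[of j] show ?thesis by linarith
    qed
    then have s: "summable (\<lambda>j. norm (c j n))"
      by (intro summable_comparison_test'[OF summable_mult[OF assms(2), of 2]]) auto
    have "((\<lambda>j. c j n) has_sum (\<Sum>j. c j n)) UNIV"
      by (intro norm_summable_imp_has_sum s summable_sums summable_norm_cancel)
    from has_sum_cmult_left[OF this]
    show "((\<lambda>j. case (n, j) of (n, j) \<Rightarrow> c j n * z powi n) has_sum (\<Sum>j. c j n) * z powi n) UNIV"
      by simp
  qed
qed

text \<open>A monotone summable majorant satisfies $N\,G(2N) \to 0$.\<close>
lemma beurling_bound_tail: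
  assumes "beurling_bound a C" "0 < e"
  obtains N where "beurling_bound (\<lambda>n. if \<bar>n\<bar> \<le> int N then 0 else a n) e"
proof -
  obtain G where G: "antimono G" "\<And>n. norm (a n) \<le> G (nat \<bar>n\<bar>)" "\<And>k. 0 \<le> G k" "summable G" "suminf G \<le> C"
    using assms(1) by (rule beurling_boundE) blast
  obtain N where N: "\<And>n. n \<ge> N \<Longrightarrow> norm (\<Sum>i. G (i + n)) < e / 3"
    using suminf_exist_split[OF _ G(4), of "e / 3"] assms(2) by auto
  \<comment> \<open>The truncated sequence vanishes up to \<open>2 * N\<close>, so the majorant may
    be frozen at its value there.\<close>
  define H where "H k = G (max k (2 * N))" for k
  have "(\<lambda>k. H (k + 2 * N)) = (\<lambda>k. G (k + 2 * N))" by (simp add: H_def)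
  moreover have sG: "summable (\<lambda>k. G (k + m))" for m using G(4) by (rule summable_ignore_initial_segment)
  ultimately have sH: "summable H" using summable_iff_shift[of H "2 * N"] by simp
  have "suminf H = (\<Sum>k. H (k + 2 * N)) + (\<Sum>k<2 * N. H k)"
    by (rule suminf_split_initial_segment[OF sH])
  also have "(\<Sum>k. H (k + 2 * N)) = (\<Sum>k. G (k + 2 * N))" by (simp add: H_def)
  also have "(\<Sum>k<2 * N. H k) = 2 * (\<Sum>k<N. G (2 * N))" by (simp add: H_def max_def)
  also have "(\<Sum>k<N. G (2 * N)) \<le> (\<Sum>k<N. G (k + N))"
    by (intro sum_mono antimonoD[OF G(1)]) auto
  also have "\<dots> \<le> (\<Sum>k. G (k + N))"
    by (intro sum_le_suminf sG) (use G(3) in auto)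
  finally have "suminf H \<le> e"
    using N[of N] N[of "2 * N"] by simp
  with sH have "beurling_bound (\<lambda>n. if \<bar>n\<bar> \<le> int (2 * N) then 0 else a n) e"
  proof (intro beurling_boundI[where G = H])
    show "antimono H" unfolding H_def by (intro antimonoI antimonoD[OF G(1)]) auto
    show "norm (if \<bar>n\<bar> \<le> int (2 * N) then 0 else a n) \<le> H (nat \<bar>n\<bar>)" for n
      using G(2)[of n] G(3) by (auto simp: H_def max_def)
  qed auto
  with that show ?thesis by blast
qed

section \<open>Laurent expansions on an annulus\<close>

lemma has_integral_cis_int:
  "((\<lambda>t. cis (of_int m * t)) has_integral (if m = 0 then 2 * pi else 0)) {0..2 * pi}"
proof (cases "m = 0")
  case True
  then show ?thesis
    using has_integral_const_real[of "1 :: complex" 0 "2 * pi"] by (simp add: scaleR_conv_of_real)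
next
  case False
  let ?F = "\<lambda>t. exp (of_real t * (\<i> * of_int m)) / (\<i> * of_int m)"
  have "((\<lambda>t. exp (of_real t * (\<i> * of_int m))) has_integral (?F (2 * pi) - ?F 0)) {0..2 * pi}"
  proof (rule fundamental_theorem_of_calculus)
    show "(?F has_vector_derivative exp (of_real t * (\<i> * of_int m))) (at t within {0..2 * pi})" for t
    proof -
      have "((\<lambda>w. exp (w * (\<i> * of_int m)) / (\<i> * of_int m)) has_field_derivative exp (of_real t * (\<i> * of_int m))) (at (of_real t))"
        using False by (auto intro!: derivative_eq_intros)
      from has_vector_derivative_real_field[OF this] show ?thesis .
    qed
  qed simp
  moreover have "exp (of_real t * (\<i> * of_int m)) = cis (of_int m * t)" for t
    by (simp add: cis_conv_exp mult_ac)
  moreover have "?F (2 * pi) = ?F 0"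
    using cis_multiple_2pi[of "of_int m"] by (simp add: cis_conv_exp mult_ac)
  ultimately show ?thesis using False by simp
qed

text \<open>Weierstrass M-test: the norm of each term is constant on the circle, and unconditional
  convergence of complex series is absolute. It yields both Cauchy's estimate and the continuity of
  the given function on the unit circle.\<close>

lemma uniform_limit_laurent:
  fixes b :: "int \<Rightarrow> complex"
  assumes "\<And>z. norm z = r \<Longrightarrow> ((\<lambda>n. b n * z powi n) has_sum h z) UNIV" "0 \<le> r"
  shows "uniform_limit (sphere 0 r) (\<lambda>F z. \<Sum>n\<in>F. b n * z powi n) h (finite_subsets_at_top UNIV)"
proof (rule Weierstrass_m_test_general')
  show "norm (b n * z powi n) \<le> norm (b n) * r powi n" if "z \<in> sphere 0 r" for n z
    using that by (simp add: norm_mult norm_power_int)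
  have "(\<lambda>n. norm (b n * of_real r powi n)) summable_on UNIV"
    using assms by (intro summable_on_iff_abs_summable_on_complex[THEN iffD1] has_sum_imp_summable[OF assms(1)]) auto
  then show "(\<lambda>n. norm (b n) * r powi n) summable_on UNIV"
    using assms(2) by (simp add: norm_mult norm_power_int)
qed (use assms in auto)

text \<open>Cauchy's estimate. Uniform convergence replaces \<open>h\<close> by a finite partial sum
  up to an error \<open>e\<close>; integrating that sum against a character isolates the
  coefficient, and no regularity of \<open>h\<close> enters.\<close>

lemma laurent_coefficient_bound:
  fixes b :: "int \<Rightarrow> complex"
  assumes "\<And>z. norm z = r \<Longrightarrow> ((\<lambda>n. b n * z powi n) has_sum h z) UNIV"
    and "\<And>z. norm z = r \<Longrightarrow> norm (h z) \<le> M" and "0 < r"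
  shows "norm (b k) * r powi k \<le> M"
proof (rule field_le_epsilon)
  fix e :: real assume "0 < e"
  have "\<forall>\<^sub>F F in finite_subsets_at_top UNIV. \<forall>z\<in>sphere 0 r. dist (\<Sum>n\<in>F. b n * z powi n) (h z) < e"
    using uniform_limitD[OF uniform_limit_laurent[OF assms(1)] \<open>0 < e\<close>] assms(3) by simp
  then obtain F0 where F0: "finite F0"
    "\<And>F. finite F \<Longrightarrow> F0 \<subseteq> F \<Longrightarrow> \<forall>z\<in>sphere 0 r. dist (\<Sum>n\<in>F. b n * z powi n) (h z) < e"
    unfolding eventually_finite_subsets_at_top by auto
  \<comment> \<open>Inserting \<open>k\<close> ensures that the wanted coefficient occurs in the
    partial sum.\<close>
  define F where "F = insert k F0"
  define T where "T z = (\<Sum>n\<in>F. b n * z powi n)" for z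
  have F: "finite F" "k \<in> F" using F0 by (auto simp: F_def)
  have T_le: "norm (T z) \<le> M + e" if "norm z = r" for z
  proof -
    have "dist (T z) (h z) < e"
      unfolding T_def using F0(2)[OF F(1)] that by (force simp: F_def)
    then show ?thesis
      using assms(2)[OF that] norm_triangle_ineq2[of "T z" "h z"] by (simp add: dist_norm)
  qed
  have T_cis: "T (of_real r * cis t) * cis (- of_int k * t)
      = (\<Sum>n\<in>F. b n * of_real r powi n * cis (of_int (n - k) * t))" for t
  proof -
    have "cis (of_int n * t) * cis (- of_int k * t) = cis (of_int (n - k) * t)" for n
      by (simp add: cis_mult algebra_simps)
    then show ?thesis
      unfolding T_def sum_distrib_right
      by (intro sum.cong refl) (simp add: power_int_mult_distrib cis_power_int mult.assoc)
  qed
  have "((\<lambda>t. T (of_real r * cis t) * cis (- of_int k * t)) has_integral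
      (\<Sum>n\<in>F. b n * of_real r powi n * (if n - k = 0 then 2 * pi else 0))) {0..2 * pi}"
    unfolding T_cis by (intro has_integral_sum F has_integral_mult_right has_integral_cis_int)
  also have "(\<Sum>n\<in>F. b n * of_real r powi n * (if n - k = 0 then 2 * pi else 0))
      = (\<Sum>n\<in>F. if n = k then b k * of_real r powi k * (2 * pi) else 0)"
    by (intro sum.cong) auto
  also have "\<dots> = b k * of_real r powi k * (2 * pi)"
    using F by simp
  finally have "((\<lambda>t. T (of_real r * cis t) * cis (- of_int k * t)) has_integral
      (b k * of_real r powi k * (2 * pi))) (cbox 0 (2 * pi))" by simp
  moreover have "0 \<le> M + e"
    using T_le[of "of_real r"] assms(3) norm_ge_zero order_trans by (metis abs_of_pos norm_of_real)
  ultimately have "norm (b k * of_real r powi k * (2 * pi)) \<le> (M + e) * measure lborel (cbox 0 (2 * pi))"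
    using T_le assms(3) by (intro has_integral_bound) (auto simp: norm_mult)
  then show "norm (b k) * r powi k \<le> M + e"
    using assms(3) by (simp add: norm_mult norm_power_int)
qed

section \<open>Laurent expansion of the reciprocal of a trigonometric polynomial\<close>

lemma has_sum_geometric:
  fixes q :: complex
  assumes "norm q < 1"
  shows "((\<lambda>k. q ^ k) has_sum (1 / (1 - q))) UNIV"
  using assms
  by (intro norm_summable_imp_has_sum geometric_sums) (auto simp: norm_power intro!: summable_geometric)

text \<open>Geometric series in s/z if \<open>s\<close> lies inside the inner circle, in z/s if it
  lies beyond the outer one. One coefficient sequence serves the whole closed annulus.\<close>

lemma inverse_linear_laurent:
  fixes s :: complex
  assumes "0 < \<rho>" "norm s < 1 / \<rho> \<or> \<rho> < norm s"
  obtains b where "\<And>z. 1 / \<rho> \<le> norm z \<Longrightarrow> norm z \<le> \<rho> \<Longrightarrow>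
    ((\<lambda>n. b n * z powi n) has_sum (1 / (z - s))) UNIV"
proof (cases "norm s < 1 / \<rho>")
  case True
  define b where "b n = (if n < 0 then s ^ nat (- n - 1) else 0)" for n :: int
  have "((\<lambda>n. b n * z powi n) has_sum (1 / (z - s))) UNIV" if z: "1 / \<rho> \<le> norm z" for z
  proof -
    \<comment> \<open>The exponent of \<open>z\<close> in \<open>1 / z * (s / z) ^ k\<close>; it
      runs through the negative integers.\<close>
    let ?h = "\<lambda>k::nat. - int k - 1"
    have "0 < 1 / \<rho>" using assms(1) by simp
    with z have z0: "z \<noteq> 0" by auto
    have "z \<noteq> s" using z True by auto
    have "norm (s / z) < 1"
      using z True z0 by (simp add: norm_divide)
    from has_sum_cmult_right[OF has_sum_geometric[OF this], of "1 / z"]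
    have "((\<lambda>k. 1 / z * (s / z) ^ k) has_sum (1 / (z - s))) UNIV"
      using z0 \<open>z \<noteq> s\<close> by (simp add: divide_simps)
    moreover have "1 / z * (s / z) ^ k = b (?h k) * z powi ?h k" for k
      using z0 by (simp add: b_def power_int_diff power_int_minus power_divide divide_simps)
    ultimately have "(((\<lambda>n. b n * z powi n) \<circ> ?h) has_sum (1 / (z - s))) UNIV"
      by (simp add: o_def)
    then have "((\<lambda>n. b n * z powi n) has_sum (1 / (z - s))) (range ?h)"
      by (subst has_sum_reindex) (auto intro!: injI)
    moreover have "n \<in> range ?h" if "n < 0" for n
      by (rule image_eqI[of _ _ "nat (- n - 1)"]) (use that in auto)
    ultimately show ?thesis
      by (subst has_sum_cong_neutral[where T = "range ?h"]) (auto simp: b_def)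
  qed
  with that show ?thesis by blast
next
  case False
  with assms have s: "\<rho> < norm s" by simp
  define b where "b n = (if n < 0 then 0 else - ((1 / s) ^ (nat n + 1)))" for n :: int
  have "((\<lambda>n. b n * z powi n) has_sum (1 / (z - s))) UNIV" if z: "norm z \<le> \<rho>" for z
  proof -
    have s0: "s \<noteq> 0" "z \<noteq> s" using s z assms(1) by auto
    have "norm (z / s) < 1"
      using z s s0 by (simp add: norm_divide)
    from has_sum_cmult_right[OF has_sum_geometric[OF this], of "- (1 / s)"]
    moreover have "1 - z / s = (s - z) / s" using s0 by (simp add: diff_divide_distrib)
    then have "- (1 / s) * (1 / (1 - z / s)) = 1 / (z - s)"
      using s0 minus_divide_right[of 1 "s - z"] by simp
    ultimately have "((\<lambda>k. - (1 / s) * (z / s) ^ k) has_sum (1 / (z - s))) UNIV"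
      by simp
    moreover have "- (1 / s) * (z / s) ^ k = b (int k) * z powi int k" for k
      by (simp add: b_def power_divide)
    ultimately have "(((\<lambda>n. b n * z powi n) \<circ> int) has_sum (1 / (z - s))) UNIV"
      by (simp add: o_def)
    then have "((\<lambda>n. b n * z powi n) has_sum (1 / (z - s))) (range int)"
      by (subst has_sum_reindex) auto
    moreover have "n \<in> range int" if "\<not> n < 0" for n
      by (rule image_eqI[of _ _ "nat n"]) (use that in auto)
    ultimately show ?thesis
      by (subst has_sum_cong_neutral[where T = "range int"]) (auto simp: b_def)
  qed
  with that show ?thesis by blast
qed

text \<open>Split off one root at a time. A root avoids the annulus, so the reciprocal of its linear
  factor expands there, and convolution multiplies this expansion by that of the cofactor.\<close>

lemma inverse_poly_laurent:
  fixes p :: "complex poly"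
  assumes "0 < \<rho>" "\<And>z. 1 / \<rho> \<le> norm z \<Longrightarrow> norm z \<le> \<rho> \<Longrightarrow> poly p z \<noteq> 0" "p \<noteq> 0"
  shows "\<exists>b. \<forall>z. 1 / \<rho> \<le> norm z \<and> norm z \<le> \<rho> \<longrightarrow>
    ((\<lambda>n. b n * z powi n) has_sum (1 / poly p z)) UNIV"
  using assms(2,3)
proof (induction "degree p" arbitrary: p)
  case 0
  then obtain c where c: "p = [:c:]" by (metis degree_eq_zeroE)
  have "((\<lambda>n. (if n = 0 then 1 / c else 0) * z powi n) has_sum (1 / poly p z)) UNIV" for z
    using has_sum_monomial[of 0 "1 / c" z] c by simp
  then show ?case by (intro exI[of _ "\<lambda>n. if n = 0 then 1 / c else 0"]) simp
next
  case (Suc d)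
  then have "\<not> constant (poly p)" by (simp add: constant_degree)
  then obtain s where s: "poly p s = 0" using fundamental_theorem_of_algebra by blast
  then obtain q where q: "p = [:- s, 1:] * q" by (metis dvdE poly_eq_0_iff_dvd)
  with Suc.prems have "q \<noteq> 0" by auto
  then have "degree p = Suc (degree q)" unfolding q by (subst degree_mult_eq) auto
  then have dq: "d = degree q" using Suc.hyps by simp
  have pq: "poly p z = (z - s) * poly q z" for z unfolding q by (simp add: algebra_simps)
  obtain b where b: "\<And>z. 1 / \<rho> \<le> norm z \<and> norm z \<le> \<rho> \<Longrightarrow>
    ((\<lambda>n. b n * z powi n) has_sum (1 / poly q z)) UNIV"
    using Suc.hyps(1)[OF dq] Suc.prems(1) \<open>q \<noteq> 0\<close> unfolding pq by fastforce
  have "norm s < 1 / \<rho> \<or> \<rho> < norm s" using Suc.prems(1)[of s] s by linarith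
  then obtain c where c: "\<And>z. 1 / \<rho> \<le> norm z \<Longrightarrow> norm z \<le> \<rho> \<Longrightarrow>
    ((\<lambda>n. c n * z powi n) has_sum (1 / (z - s))) UNIV"
    using inverse_linear_laurent[OF assms(1)] by metis
  have "((\<lambda>n. conv c b n * z powi n) has_sum (1 / poly p z)) UNIV"
    if "1 / \<rho> \<le> norm z" "norm z \<le> \<rho>" for z
  proof -
    have "0 < 1 / \<rho>" using assms(1) by simp
    with that have "z \<noteq> 0" by auto
    from has_sum_conv[OF this c b] that show ?thesis by (simp add: pq)
  qed
  then show ?case by blast
qed

text \<open>Multiplying by the N-th power of \<open>z\<close> clears the negative exponents and
  leaves a polynomial. Its reciprocal is then shifted back by convolution with a unit mass at
  \<open>N\<close>.\<close>

lemma inverse_trig_poly_laurent: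
  fixes a :: "int \<Rightarrow> complex"
  assumes "0 < \<rho>" "1 / \<rho> \<le> \<rho>"
    and "\<And>z. 1 / \<rho> \<le> norm z \<Longrightarrow> norm z \<le> \<rho> \<Longrightarrow> (\<Sum>n\<in>{-int N..int N}. a n * z powi n) \<noteq> 0"
  shows "\<exists>b. \<forall>z. 1 / \<rho> \<le> norm z \<and> norm z \<le> \<rho> \<longrightarrow>
    ((\<lambda>n. b n * z powi n) has_sum (1 / (\<Sum>n\<in>{-int N..int N}. a n * z powi n))) UNIV"
proof -
  let ?P = "\<lambda>z. \<Sum>n\<in>{-int N..int N}. a n * z powi n"
  define p where "p = (\<Sum>n\<in>{-int N..int N}. monom (a n) (nat (n + int N)))"
  have nz: "z \<noteq> 0" if "1 / \<rho> \<le> norm z" for z :: complex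
  proof -
    have "0 < 1 / \<rho>" using assms(1) by simp
    with that show ?thesis by auto
  qed
  have p: "poly p z = z powi int N * ?P z" if "z \<noteq> 0" for z
    unfolding p_def poly_sum poly_monom sum_distrib_left
  proof (rule sum.cong)
    fix n assume "n \<in> {-int N..int N}"
    then have "z ^ nat (n + int N) = z powi (n + int N)" by (simp add: power_int_def)
    also have "\<dots> = z powi n * z powi int N" using that by (intro power_int_add) auto
    finally show "a n * z ^ nat (n + int N) = z powi int N * (a n * z powi n)" by simp
  qed simp
  have p_nz: "poly p z \<noteq> 0" if "1 / \<rho> \<le> norm z" "norm z \<le> \<rho>" for z
    using p[OF nz] assms(3) nz that by auto
  \<comment> \<open>The condition 1 / \<rho> \<le> \<rho> places the point \<rho> in the annulus,
    where \<open>p\<close> does not vanish.\<close>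
  have "p \<noteq> 0" using p_nz[of "of_real \<rho>"] assms(1,2) by auto
  with inverse_poly_laurent[of \<rho> p] assms(1) p_nz obtain b where b:
    "\<And>z. 1 / \<rho> \<le> norm z \<and> norm z \<le> \<rho> \<Longrightarrow> ((\<lambda>n. b n * z powi n) has_sum (1 / poly p z)) UNIV"
    by blast
  have "((\<lambda>n. conv (\<lambda>n. if n = int N then 1 else 0) b n * z powi n) has_sum (1 / ?P z)) UNIV"
    if z: "1 / \<rho> \<le> norm z" "norm z \<le> \<rho>" for z
  proof -
    have "z \<noteq> 0" using nz z by blast
    from has_sum_conv[OF this has_sum_monomial[of "int N" 1 z] b] z
    show ?thesis using p[OF \<open>z \<noteq> 0\<close>] \<open>z \<noteq> 0\<close> by simp
  qed
  then show ?thesis by blast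
qed

section \<open>Coefficients of powers\<close>

text \<open>Iterated convolution; each factor costs 8 times its bound. The bound is conditional
  because one use, powers of the small remainder, needs it, while the other, powers of a reciprocal
  on an annulus, takes only the expansion.\<close>

lemma laurent_power:
  assumes "\<And>z. z \<in> S \<Longrightarrow> ((\<lambda>n. b n * z powi n) has_sum h z) UNIV" "0 \<notin> S"
  shows "\<exists>c. (\<forall>z\<in>S. ((\<lambda>n. c n * z powi n) has_sum (h z ^ j)) UNIV) \<and>
    (\<forall>e. beurling_bound b e \<longrightarrow> beurling_bound c ((8 * e) ^ j))"
proof (induction j)
  case 0
  show ?case
    using has_sum_monomial[of 0 1] beurling_bound_delta
    by (intro exI[of _ "\<lambda>n. if n = 0 then 1 else 0"]) auto
next
  case (Suc j)
  then obtain c where c: "\<And>z. z \<in> S \<Longrightarrow> ((\<lambda>n. c n * z powi n) has_sum (h z ^ j)) UNIV"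
    "\<And>e. beurling_bound b e \<Longrightarrow> beurling_bound c ((8 * e) ^ j)" by blast
  show ?case
  proof (intro exI[of _ "conv b c"] conjI ballI allI impI)
    show "((\<lambda>n. conv b c n * z powi n) has_sum (h z ^ Suc j)) UNIV" if "z \<in> S" for z
    proof -
      have "z \<noteq> 0" using that assms(2) by blast
      from has_sum_conv[OF this assms(1) c(1)] that show ?thesis by simp
    qed
    show "beurling_bound (conv b c) ((8 * e) ^ Suc j)" if "beurling_bound b e" for e
      using beurling_bound_conv[OF that c(2)[OF that]] by simp
  qed
qed

text \<open>Cauchy's estimates are applied to the power of \<open>h\<close> itself, so the bound
  grows in \<open>j\<close> at the rate \<open>M\<close>, the supremum bound, and not at 8 times the
  Beurling bound of \<open>b\<close>. The other factor depends only on \<rho>.\<close>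

lemma beurling_bound_laurent_power:
  assumes "1 < \<rho>"
    and "\<And>z. 1 / \<rho> \<le> norm z \<Longrightarrow> norm z \<le> \<rho> \<Longrightarrow> ((\<lambda>n. b n * z powi n) has_sum h z) UNIV"
    and "\<And>z. 1 / \<rho> \<le> norm z \<Longrightarrow> norm z \<le> \<rho> \<Longrightarrow> norm (h z) \<le> M"
  shows "\<exists>c. (\<forall>z\<in>sphere 0 1. ((\<lambda>n. c n * z powi n) has_sum (h z ^ j)) UNIV) \<and>
    beurling_bound c (M ^ j / (1 - 1 / \<rho>))"
proof -
  let ?S = "{z :: complex. 1 / \<rho> \<le> norm z \<and> norm z \<le> \<rho>}"
  have \<rho>: "1 / \<rho> \<le> 1" "1 / \<rho> < 1" "0 < 1 / \<rho>" "1 / \<rho> \<le> \<rho>" 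
  proof -
    show "1 / \<rho> \<le> 1" "1 / \<rho> < 1" "0 < 1 / \<rho>" using assms(1) by auto
    then show "1 / \<rho> \<le> \<rho>" using assms(1) by linarith
  qed
  have "0 \<notin> ?S" using \<rho> by simp
  then obtain c where c: "\<And>z. z \<in> ?S \<Longrightarrow> ((\<lambda>n. c n * z powi n) has_sum (h z ^ j)) UNIV"
    using laurent_power[of ?S b h j] assms(2) by auto
  have coeff: "norm (c k) * r powi k \<le> M ^ j" if "r = \<rho> \<or> r = 1 / \<rho>" for k r
  proof (rule laurent_coefficient_bound[of r c "\<lambda>z. h z ^ j"])
    fix z :: complex assume "norm z = r"
    then have z: "1 / \<rho> \<le> norm z" "norm z \<le> \<rho>" using that \<rho> by auto
    show "((\<lambda>n. c n * z powi n) has_sum h z ^ j) UNIV" using c z by auto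
    show "norm (h z ^ j) \<le> M ^ j" unfolding norm_power by (intro power_mono assms(3) z) auto
  qed (use that assms(1) in auto)
  \<comment> \<open>The outer circle gives the decay for nonnegative \<open>k\<close>, the inner
    circle for negative \<open>k\<close>.\<close>
  have "norm (c k) \<le> M ^ j * (1 / \<rho>) ^ nat \<bar>k\<bar>" for k
  proof (cases "0 \<le> k")
    case True
    then show ?thesis using coeff[of \<rho> k] assms(1)
      by (simp add: power_int_def power_divide pos_le_divide_eq)
  next
    case False
    then show ?thesis using coeff[of "1 / \<rho>" k] assms(1)
      by (simp add: power_int_def power_divide pos_le_divide_eq)
  qed
  moreover have "0 \<le> M" using assms(3)[of 1] assms(1) norm_ge_zero[of "h 1"] \<rho> by (simp del: norm_ge_zero)
  ultimately have "beurling_bound c (M ^ j / (1 - 1 / \<rho>))"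
    using \<rho> by (intro beurling_bound_geometric) auto
  moreover have "sphere 0 1 \<subseteq> ?S" using \<rho> assms(1) by auto
  ultimately show ?thesis using c by blast
qed

text \<open>Compare \<open>z\<close> with its radial projection \<open>sgn z\<close> onto the unit
  circle, using uniform continuity on the compact annulus between radii 1/2 and 2.\<close>

lemma lower_bound_annulus:
  fixes P :: "complex \<Rightarrow> complex"
  assumes "continuous_on (- {0}) P" "0 < m" "\<And>z. norm z = 1 \<Longrightarrow> m \<le> norm (P z)"
  obtains \<rho> where "1 < \<rho>" "\<And>z. 1 / \<rho> \<le> norm z \<Longrightarrow> norm z \<le> \<rho> \<Longrightarrow> m / 2 \<le> norm (P z)"
proof -
  let ?K = "cball 0 2 - ball 0 (1 / 2) :: complex set"
  have "compact ?K" by (intro compact_diff) auto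
  moreover have "continuous_on ?K P" by (rule continuous_on_subset[OF assms(1)]) auto
  ultimately have "uniformly_continuous_on ?K P" by (simp add: compact_uniformly_continuous)
  then obtain d where d: "0 < d"
    "\<And>x y. x \<in> ?K \<Longrightarrow> y \<in> ?K \<Longrightarrow> dist y x < d \<Longrightarrow> dist (P y) (P x) < m / 2"
    using assms(2) unfolding uniformly_continuous_on_def by (metis half_gt_zero)
  define \<rho> where "\<rho> = 1 + min d 1 / 2"
  have \<rho>: "1 < \<rho>" "\<rho> < 1 + d" "\<rho> < 2" using d(1) by (auto simp: \<rho>_def min_def)
  \<comment> \<open>This square gives 1 - 1 / \<rho> \<le> \<rho> - 1, so the inner radius is as
    close to 1 as the outer one.\<close>
  have "0 \<le> (\<rho> - 1) * (\<rho> - 1)" by simp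
  then have inv: "2 - \<rho> \<le> 1 / \<rho>" "1 / 2 \<le> 1 / \<rho>"
    using \<rho> by (simp_all add: field_simps)
  have "m / 2 \<le> norm (P z)" if z: "1 / \<rho> \<le> norm z" "norm z \<le> \<rho>" for z
  proof -
    have z0: "z \<noteq> 0" using z inv by auto
    have sgn1: "norm (sgn z) = 1" using z0 by (simp add: norm_sgn)
    have "z - sgn z = of_real (norm z - 1) * sgn z"
      using z0 by (simp add: sgn_eq field_simps)
    then have "dist z (sgn z) = \<bar>norm z - 1\<bar>"
      using sgn1 by (simp add: dist_norm norm_mult del: of_real_diff of_real_1)
    also have "\<dots> < d" using z inv \<rho> by linarith
    finally have "dist z (sgn z) < d" .
    have "\<not> norm z < 1 / 2" "norm z \<le> 2" using z inv \<rho> by linarith+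
    then have "z \<in> ?K" by simp
    moreover have "sgn z \<in> ?K" using sgn1 by simp
    ultimately have "dist (P z) (P (sgn z)) < m / 2"
      using d(2) \<open>dist z (sgn z) < d\<close> by blast
    then show ?thesis
      using assms(3)[OF sgn1] norm_triangle_ineq2[of "P (sgn z)" "P z"]
      by (simp add: dist_norm norm_minus_commute)
  qed
  with \<rho>(1) that show ?thesis by blast
qed

section \<open>Inversion\<close>

theorem corollary1p5:
  fixes f :: "real \<Rightarrow> complex"
  assumes "f \<in> beurling_algebra"
    and "\<forall>\<xi>::real. f \<xi> \<noteq> 0"
  shows "(\<lambda>\<xi>. 1 / f \<xi>) \<in> beurling_algebra"
proof -
  obtain a where "beurling_norm a < \<infinity>"
    and a: "\<And>\<xi>. ((\<lambda>n. a n * exp (- \<i> * of_int n * of_real \<xi>)) has_sum f \<xi>) UNIV"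
    using assms(1) unfolding beurling_algebra_def by blast
  then obtain C where C: "beurling_bound a C" using beurling_bound_if_norm_finite by blast
  \<comment> \<open>With z = cis (- \<xi>) the Fourier series becomes a Laurent series on the unit
    circle.\<close>
  have exp_cis: "exp (- \<i> * of_int n * of_real \<xi>) = cis (- \<xi>) powi n" for n and \<xi> :: real
    by (simp add: cis_power_int) (simp add: cis_conv_exp mult_ac)
  define F where "F z = (\<Sum>\<^sub>\<infinity>n. a n * z powi n)" for z
  have F_f: "F (cis (- \<xi>)) = f \<xi>" for \<xi>
    using infsumI[OF a[of \<xi>]] unfolding F_def exp_cis .
  have F: "((\<lambda>n. a n * z powi n) has_sum F z) UNIV" if "norm z = 1" for z
    unfolding F_def
  proof (rule has_sum_infsum, rule abs_summable_summable)
    show "(\<lambda>n. norm (a n * z powi n)) summable_on UNIV"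
      using beurling_bound_abs_summable(1)[OF C] that by (simp add: norm_mult norm_power_int)
  qed
  have "continuous_on (sphere 0 1) F"
  proof (rule uniform_limit_theorem[OF _ uniform_limit_laurent[OF F]])
    show "\<forall>\<^sub>F A in finite_subsets_at_top UNIV. continuous_on (sphere 0 1) (\<lambda>z. \<Sum>n\<in>A. a n * z powi n)"
      by (intro always_eventually allI continuous_intros) auto
  qed auto
  then have "continuous_on (sphere 0 1) (\<lambda>z. norm (F z))" by (rule continuous_on_norm)
  from continuous_attains_inf[OF _ _ this] obtain z0 where z0: "norm z0 = 1"
    "\<And>z. norm z = 1 \<Longrightarrow> norm (F z0) \<le> norm (F z)" by auto
  define m where "m = norm (F z0)"
  \<comment> \<open>The minimum over the circle is thus attained at a value of \<open>f\<close>,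
    hence is positive.\<close>
  have "cis (Arg z0) = z0"
    using z0(1) by (subst cis_Arg) (auto simp: sgn_eq)
  then have "F z0 = f (- Arg z0)" using F_f[of "- Arg z0"] by simp
  with assms(2) have m: "0 < m" by (simp add: m_def)
  \<comment> \<open>The reciprocal of the polynomial part will be bounded by \<open>M\<close> near
    the circle, since \<open>m / 2\<close> on the circle drops to \<open>m / 4\<close> on the
    annulus. Then \<open>e\<close> makes \<open>8 * e * M\<close> equal to 1/2, where 8 is the
    convolution constant.\<close>
  define e where "e = m / 64"
  define M where "M = 4 / m"
  obtain N where N: "beurling_bound (\<lambda>n. if \<bar>n\<bar> \<le> int N then 0 else a n) e"
    using beurling_bound_tail[OF C, of e] m by (auto simp: e_def)
  define u where "u n = (if \<bar>n\<bar> \<le> int N then 0 else - a n)" for n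
  have u_norm: "norm (u n) = norm (if \<bar>n\<bar> \<le> int N then 0 else a n)" for n
    by (simp add: u_def)
  have u_e: "beurling_bound u e" using N unfolding beurling_bound_def u_norm .
  define P where "P z = (\<Sum>n\<in>{-int N..int N}. a n * z powi n)" for z
  \<comment> \<open>Since F = P - U, the coefficients \<open>u\<close> are those of the tail of
    \<open>a\<close> with the sign reversed.\<close>
  define U where "U z = P z - F z" for z
  have U: "((\<lambda>n. u n * z powi n) has_sum U z) UNIV" if "z \<in> sphere 0 1" for z
  proof -
    have "((\<lambda>n. (if \<bar>n\<bar> \<le> int N then a n else 0) * z powi n) has_sum P z) UNIV"
      unfolding P_def by (rule has_sum_finite_neutralI[of "{-int N..int N}"]) (auto intro!: sum.cong)
    from has_sum_add[OF this has_sum_cmult_right[OF F, of z "- 1"]] that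
    have "((\<lambda>n. (if \<bar>n\<bar> \<le> int N then a n else 0) * z powi n + - 1 * (a n * z powi n)) has_sum U z) UNIV"
      by (simp add: U_def)
    also have "(\<lambda>n. (if \<bar>n\<bar> \<le> int N then a n else 0) * z powi n + - 1 * (a n * z powi n)) = (\<lambda>n. u n * z powi n)"
      by (auto simp: u_def)
    finally show ?thesis .
  qed
  have U_le: "norm (U z) \<le> 2 * e" if "norm z = 1" for z
  proof -
    note l1 = beurling_bound_abs_summable[OF u_e]
    have "((\<lambda>n. norm (u n * z powi n)) has_sum (\<Sum>\<^sub>\<infinity>n. norm (u n))) UNIV"
      using l1(1) that by (simp add: norm_mult norm_power_int)
    from norm_has_sum_bound[OF this U] l1(2) that show ?thesis by simp
  qed
  have "continuous_on (- {0}) P"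
    unfolding P_def by (intro continuous_intros) auto
  moreover have "m / 2 \<le> norm (P z)" if "norm z = 1" for z
  proof -
    have "norm (F z) \<le> norm (P z) + norm (U z)"
      unfolding U_def using norm_triangle_ineq4[of "P z" "P z - F z"] by simp
    then show ?thesis using z0(2)[OF that] U_le[OF that] m unfolding m_def e_def by linarith
  qed
  ultimately obtain \<rho> where \<rho>: "1 < \<rho>"
    and P_ge: "\<And>z. 1 / \<rho> \<le> norm z \<Longrightarrow> norm z \<le> \<rho> \<Longrightarrow> m / 2 / 2 \<le> norm (P z)"
    using lower_bound_annulus[of P "m / 2"] m by auto
  have \<rho>_inv: "0 < 1 / \<rho>" "1 / \<rho> < 1" using \<rho> by auto
  have P_nz: "P z \<noteq> 0" if "1 / \<rho> \<le> norm z" "norm z \<le> \<rho>" for z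
    using P_ge[OF that] m by auto
  obtain b where b: "\<And>z. 1 / \<rho> \<le> norm z \<Longrightarrow> norm z \<le> \<rho> \<Longrightarrow> ((\<lambda>n. b n * z powi n) has_sum (1 / P z)) UNIV"
    using inverse_trig_poly_laurent[of \<rho> a N] P_nz \<rho> \<rho>_inv unfolding P_def by auto
  have M: "norm (1 / P z) \<le> M" if "1 / \<rho> \<le> norm z" "norm z \<le> \<rho>" for z
    using P_ge[OF that] P_nz[OF that] m by (simp add: norm_divide M_def field_simps)
  have "\<exists>q. (\<forall>z\<in>sphere 0 1. ((\<lambda>n. q n * z powi n) has_sum ((1 / P z) ^ j)) UNIV) \<and>
      beurling_bound q (M ^ j / (1 - 1 / \<rho>))" for j
    by (rule beurling_bound_laurent_power[OF \<rho> b M])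
  then obtain q where q:
    "\<And>j z. z \<in> sphere 0 1 \<Longrightarrow> ((\<lambda>n. q j n * z powi n) has_sum ((1 / P z) ^ j)) UNIV"
    "\<And>j. beurling_bound (q j) (M ^ j / (1 - 1 / \<rho>))"
    by metis
  have "\<exists>v. (\<forall>z\<in>sphere 0 1. ((\<lambda>n. v n * z powi n) has_sum (U z ^ j)) UNIV) \<and>
      beurling_bound v ((8 * e) ^ j)" for j
    using laurent_power[of "sphere 0 1" u U j, OF U] u_e by auto
  then obtain v where v:
    "\<And>j z. z \<in> sphere 0 1 \<Longrightarrow> ((\<lambda>n. v j n * z powi n) has_sum (U z ^ j)) UNIV"
    "\<And>j. beurling_bound (v j) ((8 * e) ^ j)"
    by metis
  \<comment> \<open>Coefficients of the j-th term of the expansion of 1/F, namely the j-th power of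
    \<open>U\<close> over the (j + 1)-st power of \<open>P\<close>.\<close>
  define c where "c j = conv (v j) (q (Suc j))" for j
  define K where "K j = 8 * (8 * e) ^ j * (M ^ Suc j / (1 - 1 / \<rho>))" for j
  have c_bound: "beurling_bound (c j) (K j)" for j
    unfolding c_def K_def by (intro beurling_bound_conv v q)
  \<comment> \<open>The bounds are geometric with ratio \<open>8 * e * M\<close>. Taking the powers
    of 1/P from Cauchy's estimates keeps any bound on the Laurent coefficients of 1/P out of this
    ratio.\<close>
  have "K j = 8 * M / (1 - 1 / \<rho>) * (8 * e * M) ^ j" for j
    by (simp add: K_def power_mult_distrib)
  moreover have "8 * e * M = 1 / 2" using m by (simp add: e_def M_def)
  ultimately have "K = (\<lambda>j. 8 * M / (1 - 1 / \<rho>) * (1 / 2) ^ j)"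
    by (simp only: fun_eq_iff) simp
  then have K: "summable K"
    by (simp only:) (intro summable_mult summable_geometric, simp)
  define d where "d n = (\<Sum>j. c j n)" for n
  have d: "((\<lambda>n. d n * z powi n) has_sum (1 / F z)) UNIV" if z: "norm z = 1" for z
    unfolding d_def
  proof (rule has_sum_series[OF c_bound K z])
    have "z \<noteq> 0" using z by auto
    show "((\<lambda>n. c j n * z powi n) has_sum (U z ^ j * (1 / P z) ^ Suc j)) UNIV" for j
      unfolding c_def by (intro has_sum_conv v q \<open>z \<noteq> 0\<close>) (use z in auto)
    have Pz: "P z \<noteq> 0" "m / 4 \<le> norm (P z)" using P_nz[of z] P_ge[of z] z \<rho> \<rho>_inv by auto
    \<comment> \<open>Here \<bar>U\<bar> \<le> m/32 and \<bar>P\<bar> \<ge> m/4, so the geometric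
      series in U/P converges pointwise; its sum divided by P is 1/(P - U) = 1/F.\<close>
    have "norm (U z / P z) < 1"
      using U_le[OF z] Pz m by (simp add: norm_divide e_def)
    from sums_mult[OF geometric_sums[OF this], of "1 / P z"]
    have "(\<lambda>j. 1 / P z * (U z / P z) ^ j) sums (1 / P z * (1 / (1 - U z / P z)))" .
    also have "1 / P z * (1 / (1 - U z / P z)) = 1 / F z"
      using Pz by (simp add: U_def field_simps)
    also have "(\<lambda>j. 1 / P z * (U z / P z) ^ j) = (\<lambda>j. U z ^ j * (1 / P z) ^ Suc j)"
      by (simp add: power_divide mult_ac)
    finally show "(\<lambda>j. U z ^ j * (1 / P z) ^ Suc j) sums (1 / F z)" .
  qed
  have "beurling_norm d < \<infinity>"
    unfolding d_def by (rule beurling_norm_finite_if_bound[OF beurling_bound_series[OF c_bound K]])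
  moreover have "((\<lambda>n. d n * exp (- \<i> * of_int n * of_real \<xi>)) has_sum (1 / f \<xi>)) UNIV" for \<xi>
    using d[of "cis (- \<xi>)"] unfolding exp_cis F_f by simp
  ultimately show ?thesis
    unfolding beurling_algebra_def by blast
qed

end
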